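(* Let $V, W$ be vector spaces over a field $\mathbb{F} \neq \mathbb{Z}/2\mathbb{Z}$ with $\dim V \geqslant 2$. Suppose $f : V \to W$ is any map that takes affine lines onto affine lines (i.e., for every affine line $\ell \subseteq V$, the image $f(\ell)$ is an affine line in $W$), and such that $f(v) \notin f(\ell)$ whenever $\ell \subseteq V$ is an affine line and $v \in V \setminus \ell$. Then $f$ is injective and $\tau$-affine linear for some field automorphism $\tau$ of $\mathbb{F}$. Conversely, if $f : V \to W$ is injective and $\tau$-affine linear for some field automorphism $\tau$ of $\mathbb{F}$, then $f$ takes affine lines onto affine lines, and $f(v) \notin f(\ell)$ for every affine line $\ell \subseteq V$ and every $v \in V \setminus \ell$.
   Context: An affine line in a vector space $V$ over $\mathbb{F}$ is a subset of the form $v_0 + \mathbb{F} w = \{v_0 + \lambda w : \lambda \in \mathbb{F}\}$ with $v_0, w \in V$, $w \neq 0$. Given a field automorphism $\tau : \mathbb{F} \to \mathbb{F}$, a map $f : V \to W$ of $\mathbb{F}$-vector spaces is $\tau$-linear if $f$ is additive and $f(\lambda v) = \tau(\lambda) f(v)$ for all $\lambda \in \mathbb{F}$, $v \in V$. A map $f : V \to W$ is $\tau$-affine linear if it is the composite of a $\tau$-linear map $V \to W$ and a translation in $W$. *)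

theory Defs
  imports Complex_Main "HOL-Library.Z2"
begin

definition field_isomorphism :: "('a::field \<Rightarrow> 'b::field) \<Rightarrow> bool" where
  "field_isomorphism \<phi> \<longleftrightarrow>
     bij \<phi> \<and> \<phi> 1 = 1 \<and>
     (\<forall>x y. \<phi> (x + y) = \<phi> x + \<phi> y) \<and> (\<forall>x y. \<phi> (x * y) = \<phi> x * \<phi> y)"

abbreviation field_automorphism :: "('a::field \<Rightarrow> 'a) \<Rightarrow> bool" where
  "field_automorphism \<equiv> field_isomorphism"

(* The library function dim is 0 on spaces without a finite basis, so it cannot express a
   lower bound on a possibly infinite dimension. By invariance of the cardinality of a basis,
   the choice of B below is immaterial. *)
definition (in vector_space) dim_at_least :: "nat \<Rightarrow> bool" where
  "dim_at_least n \<longleftrightarrow>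
     (\<exists>B. independent B \<and> span B = UNIV \<and> (infinite B \<or> n \<le> card B))"

definition affine_line :: "('a::field \<Rightarrow> 'v::ab_group_add \<Rightarrow> 'v) \<Rightarrow> 'v set \<Rightarrow> bool" where
  "affine_line scale L \<longleftrightarrow> (\<exists>v\<^sub>0 w. w \<noteq> 0 \<and> L = {v\<^sub>0 + scale c w |c. True})"

definition tau_linear ::
  "('a::field \<Rightarrow> 'v::ab_group_add \<Rightarrow> 'v) \<Rightarrow> ('a \<Rightarrow> 'w::ab_group_add \<Rightarrow> 'w) \<Rightarrow>
   ('a \<Rightarrow> 'a) \<Rightarrow> ('v \<Rightarrow> 'w) \<Rightarrow> bool" where
  "tau_linear scaleV scaleW \<tau> g \<longleftrightarrow>
     additive g \<and> (\<forall>c v. g (scaleV c v) = scaleW (\<tau> c) (g v))"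

definition tau_affine_linear ::
  "('a::field \<Rightarrow> 'v::ab_group_add \<Rightarrow> 'v) \<Rightarrow> ('a \<Rightarrow> 'w::ab_group_add \<Rightarrow> 'w) \<Rightarrow>
   ('a \<Rightarrow> 'a) \<Rightarrow> ('v \<Rightarrow> 'w) \<Rightarrow> bool" where
  "tau_affine_linear scaleV scaleW \<tau> f \<longleftrightarrow>
     (\<exists>g w\<^sub>0. tau_linear scaleV scaleW \<tau> g \<and> f = (\<lambda>w. w + w\<^sub>0) \<circ> g)"

end

theory Submission
  imports Defs
begin

text \<open>
  Write \<open>F\<close> for the field and normalise to \<open>f 0 = 0\<close>. If \<open>a\<close>
  and \<open>b\<close> are independent, every point of their plane lies on a line joining a point of
  \<open>Fa\<close> to a point of \<open>Fb\<close>, because \<open>F\<close> has a scalar other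
  than 0 and 1; so the plane is mapped into the plane of \<open>f a\<close> and \<open>f b\<close>.
  The line \<open>b + Fa\<close> is disjoint from \<open>Fa\<close>, so its image is a line of the
  image plane disjoint from \<open>F(f a)\<close>, that is, parallel to it. Hence \<open>f\<close>
  maps parallelograms to parallelograms and is additive on independent pairs; a third vector off the
  line handles dependent pairs. The scalar functions on different lines through 0 agree by comparing
  \<open>a\<close>, \<open>b\<close> and \<open>a + b\<close>.
\<close>

section \<open>The conditions on the field and on the dimension\<close>

lemma exists_scalar_neq_0_1:
  assumes "\<not> (\<exists>\<phi> :: 'a::field \<Rightarrow> bit. field_isomorphism \<phi>)"
  shows "\<exists>k::'a. k \<noteq> 0 \<and> k \<noteq> 1"
proof (rule ccontr)
  assume "\<not> ?thesis"
  then have all: "x = 0 \<or> x = 1" for x :: 'a by blast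
  have two: "(1::'a) + 1 = 0" using all[of "1 + 1"] by (metis add_cancel_right_right zero_neq_one)
  define \<phi> :: "'a \<Rightarrow> bit" where "\<phi> x = (if x = 0 then 0 else 1)" for x
  have "bij \<phi>"
  proof (rule bijI)
    show "inj \<phi>" unfolding inj_def \<phi>_def using all by (metis zero_neq_one)
    show "surj \<phi>" unfolding surj_def \<phi>_def by (metis bit_not_zero_iff zero_neq_one)
  qed
  moreover have "\<phi> (x + y) = \<phi> x + \<phi> y" for x y
    using all[of x] all[of y] two by (auto simp: \<phi>_def)
  moreover have "\<phi> (x * y) = \<phi> x * \<phi> y" for x y
    by (auto simp: \<phi>_def)
  ultimately have "field_isomorphism \<phi>" by (auto simp: field_isomorphism_def \<phi>_def)
  with assms show False by blast
qed

text \<open>A line through 0 cannot contain two independent vectors \<open>x\<close> and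
  \<open>y\<close>: if \<open>x\<close> lies in \<open>span {a}\<close>, exchange puts
  \<open>a\<close> into \<open>span {x}\<close>, and then \<open>y\<close> is outside.\<close>

lemma (in vector_space) dim_at_least_2_off_line:
  assumes "dim_at_least 2"
  shows "\<exists>c. c \<notin> span {a}"
proof -
  obtain B where B: "independent B" "infinite B \<or> 2 \<le> card B"
    using assms by (auto simp: dim_at_least_def)
  then obtain C where C: "C \<subseteq> B" "card C = 2"
    by (metis infinite_arbitrarily_large obtain_subset_with_card_n)
  then obtain x y where xy: "C = {x, y}" "x \<noteq> y" by (meson card_2_iff)
  have ind: "independent {x, y}" using independent_mono[OF B(1) C(1)] xy by simp
  then have y: "y \<notin> span {x}"
    using xy(2) independent_insert[of y "{x}"] by (simp add: insert_commute)
  have x: "x \<noteq> 0" using ind dependent_zero[of "{x, y}"] by blast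
  show ?thesis
  proof (cases "x \<in> span {a}")
    case True
    moreover have "x \<notin> span {}" using x by simp
    ultimately have "a \<in> span {x}" using in_span_insert[of x a "{}"] by simp
    then have "span {a} \<subseteq> span {x}" by (simp add: span_minimal)
    with y show ?thesis by blast
  qed blast
qed

text \<open>The condition on points off a line enters as injectivity, those on the field and the
  dimension as \<open>scalar\<close> and \<open>off_line\<close>. Fixing 0 costs only a
  translation.\<close>

locale injective_line_map = vector_space_pair s1 s2
  for s1 :: "'a::field \<Rightarrow> 'v::ab_group_add \<Rightarrow> 'v" and s2 :: "'a \<Rightarrow> 'w::ab_group_add \<Rightarrow> 'w" +
  fixes f :: "'v \<Rightarrow> 'w"
  assumes inj: "inj f"
    and f_0 [simp]: "f 0 = 0"
    and line: "affine_line s1 L \<Longrightarrow> affine_line s2 (f ` L)"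
    and scalar: "\<exists>k::'a. k \<noteq> 0 \<and> k \<noteq> 1"
    and off_line: "\<exists>c. c \<notin> vs1.span {a}"
begin

section \<open>Images of lines\<close>

lemma f_eq_0_iff [simp]: "f a = 0 \<longleftrightarrow> a = 0"
  using inj f_0 by (metis injD)

text \<open>The image is a line through the distinct points \<open>f v\<close> and
  \<open>f (v + w)\<close>, so it can be based at the first with their difference as direction. This
  is an equality of sets: equal parameters \<open>c\<close> on the two sides need not
  correspond.\<close>

lemma image_line:
  assumes "w \<noteq> 0"
  shows "f ` range (\<lambda>c. v + s1 c w) = range (\<lambda>c. f v + s2 c (f (v + w) - f v))"
proof -
  let ?L = "range (\<lambda>c. v + s1 c w)"
  have "affine_line s1 ?L"
    unfolding affine_line_def full_SetCompr_eq using assms by blast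
  from line[OF this] obtain p d where d: "d \<noteq> 0" and im: "f ` ?L = range (\<lambda>c. p + s2 c d)"
    by (auto simp: affine_line_def full_SetCompr_eq)
  have "v \<in> ?L" by (rule range_eqI[of _ _ 0]) simp
  then obtain x where x: "f v = p + s2 x d" using im by blast
  have "v + w \<in> ?L" by (rule range_eqI[of _ _ 1]) simp
  then obtain y where y: "f (v + w) = p + s2 y d" using im by blast
  have "x \<noteq> y"
  proof
    assume "x = y"
    then have "f v = f (v + w)" using x y by simp
    then show False using injD[OF inj] assms by fastforce
  qed
  have diff: "f (v + w) - f v = s2 (y - x) d"
    by (simp add: x y vs2.scale_left_diff_distrib)
  show ?thesis unfolding im diff
  proof (intro equalityI image_subsetI)
    fix c
    have "x + (c - x) / (y - x) * (y - x) = c" using \<open>x \<noteq> y\<close> by simp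
    then have "f v + s2 ((c - x) / (y - x)) (s2 (y - x) d) = p + s2 c d"
      unfolding x vs2.scale_scale add.assoc vs2.scale_left_distrib[symmetric] by simp
    then show "p + s2 c d \<in> range (\<lambda>c. f v + s2 c (s2 (y - x) d))"
      by (metis rangeI)
    show "f v + s2 c (s2 (y - x) d) \<in> range (\<lambda>c. p + s2 c d)"
      by (rule range_eqI[of _ _ "x + c * (y - x)"]) (simp add: x vs2.scale_left_distrib)
  qed
qed

lemma image_span: "f ` vs1.span {a} = vs2.span {f a}"
proof (cases "a = 0")
  case False
  then show ?thesis using image_line[of a 0] by (simp add: vs1.span_singleton vs2.span_singleton)
qed simp

text \<open>By injectivity membership is also reflected, so independence of \<open>a\<close> and
  \<open>b\<close> passes to \<open>f a\<close> and \<open>f b\<close>.\<close>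

lemma f_in_span_iff: "f b \<in> vs2.span {f a} \<longleftrightarrow> b \<in> vs1.span {a}"
  using inj_image_mem_iff[OF inj] image_span by metis

lemma f_scale: "\<exists>c. f (s1 x a) = s2 c (f a)"
proof -
  have "f (s1 x a) \<in> vs2.span {f a}"
    by (simp add: f_in_span_iff vs1.span_base vs1.span_scale)
  then show ?thesis by (auto simp: vs2.span_singleton)
qed

section \<open>Planes, parallelograms and additivity\<close>

lemma span_sym:
  assumes "b \<notin> vs1.span {a}" "a \<noteq> 0"
  shows "a \<notin> vs1.span {b}"
  using vs1.in_span_insert[of a b "{}"] assms by auto

lemma image_plane: "\<exists>u v. f (s1 x a + s1 y b) = s2 u (f a) + s2 v (f b)"
proof (cases "s1 x a = 0 \<and> s1 y b = 0")
  case True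
  then have "f (s1 x a + s1 y b) = s2 0 (f a) + s2 0 (f b)" by (simp del: vs1.scale_eq_0_iff)
  then show ?thesis by blast
next
  case False
  obtain k :: 'a where k: "k \<noteq> 0" "k \<noteq> 1" using scalar by blast
  \<comment> \<open>\<open>A\<close> and \<open>B\<close> are scaled so that the given point is
    \<open>(1 - k) A + k B\<close>, a point of the line joining them.\<close>
  define A where "A = s1 (x / (1 - k)) a"
  define B where "B = s1 (y / k) b"
  have xA: "s1 x a = s1 (1 - k) A" and yB: "s1 y b = s1 k B"
    using k by (simp_all add: A_def B_def)
  have p: "s1 x a + s1 y b = A + s1 k (B - A)"
    by (simp add: xA yB vs1.scale_left_diff_distrib vs1.scale_right_diff_distrib)
  obtain u v where A: "f A = s2 u (f a)" and B: "f B = s2 v (f b)"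
    using f_scale A_def B_def by metis
  show ?thesis
  proof (cases "A = B")
    case True
    then show ?thesis using A by (intro exI[of _ u] exI[of _ 0]) (simp add: p)
  next
    case False
    then have "f (A + s1 k (B - A)) \<in> range (\<lambda>c. f A + s2 c (f B - f A))"
      using image_line[of "B - A" A] by auto
    then obtain c where "f (A + s1 k (B - A)) = f A + s2 c (f B - f A)" by blast
    then have "f (s1 x a + s1 y b) = s2 (u - c * u) (f a) + s2 (c * v) (f b)"
      by (simp add: p A B vs2.scale_right_diff_distrib vs2.scale_left_diff_distrib)
    then show ?thesis by blast
  qed
qed

lemma image_parallel:
  assumes ab: "b \<notin> vs1.span {a}" and a: "a \<noteq> 0"
  shows "\<exists>u. f (a + b) = s2 u (f a) + f b"
proof -
  obtain u v where uv: "f (a + b) = s2 u (f a) + s2 v (f b)"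
    using image_plane[of 1 a 1 b] by auto
  have "v = 1"
  proof (rule ccontr)
    assume "v \<noteq> 1"
    \<comment> \<open>At parameter \<open>t\<close> the line through \<open>f b\<close> and
      \<open>f (b + a)\<close> has \<open>f b\<close>-coordinate 0, so it meets the span of
      \<open>f a\<close>. That line is the image of \<open>b + Fa\<close>, which misses
      \<open>Fa\<close>.\<close>
    define t where "t = 1 / (1 - v)"
    have t: "1 + t * (v - 1) = 0" using \<open>v \<noteq> 1\<close> by (simp add: t_def field_simps)
    have "f b + s2 t (f (b + a) - f b) = s2 (t * u) (f a) + s2 (1 + t * (v - 1)) (f b)"
      unfolding add.commute[of b a] uv by (simp add: algebra_simps)
    also have "\<dots> = s2 (t * u) (f a)" by (simp add: t)
    also have "\<dots> \<in> vs2.span {f a}" by (simp add: vs2.span_base vs2.span_scale)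
    finally have "f b + s2 t (f (b + a) - f b) \<in> vs2.span {f a}" .
    moreover have "f b + s2 t (f (b + a) - f b) \<in> f ` range (\<lambda>c. b + s1 c a)"
      unfolding image_line[OF a] by blast
    ultimately obtain c where "f (b + s1 c a) \<in> vs2.span {f a}" by auto
    then have "b + s1 c a \<in> vs1.span {a}" by (simp add: f_in_span_iff)
    then have "b + s1 c a - s1 c a \<in> vs1.span {a}"
      by (rule vs1.span_diff) (simp add: vs1.span_scale vs1.span_base)
    then show False using ab by simp
  qed
  with uv show ?thesis by auto
qed

lemma coeffs_eq:
  assumes ab: "b \<notin> vs1.span {a}" "a \<noteq> 0"
    and eq: "s2 u (f a) + s2 v (f b) = s2 u' (f a) + s2 v' (f b)"
  shows "u = u' \<and> v = v'"
proof -
  have eq': "s2 (v - v') (f b) = s2 (u' - u) (f a)"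
    using eq by (simp add: algebra_simps)
  have "v = v'"
  proof (rule ccontr)
    assume "v \<noteq> v'"
    then have "f b = s2 (1 / (v - v')) (s2 (v - v') (f b))" by simp
    also have "\<dots> \<in> vs2.span {f a}"
      unfolding eq' by (intro vs2.span_scale vs2.span_base) simp
    finally show False using ab by (simp add: f_in_span_iff)
  qed
  with eq' ab show ?thesis by simp
qed

text \<open>\<open>image_parallel\<close> fixes the coefficient of \<open>f b\<close>, and with
  \<open>a\<close> and \<open>b\<close> exchanged that of \<open>f a\<close>.\<close>

lemma add_independent:
  assumes ab: "b \<notin> vs1.span {a}"
  shows "f (a + b) = f a + f b"
proof (cases "a = 0")
  case False
  obtain u where u: "f (a + b) = s2 u (f a) + f b" using image_parallel[OF ab False] by blast
  have "b \<noteq> 0" using ab vs1.span_zero by metis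
  then obtain v where v: "f (b + a) = s2 v (f b) + f a"
    using image_parallel[OF span_sym[OF ab False]] by blast
  have "s2 u (f a) + s2 1 (f b) = s2 1 (f a) + s2 v (f b)"
    using u v by (simp add: add.commute)
  from coeffs_eq[OF ab False this] show ?thesis using u by simp
qed simp

lemma add: "f (a + b) = f a + f b"
proof (cases "b \<in> vs1.span {a}")
  case False
  then show ?thesis by (rule add_independent)
next
  case b: True
  \<comment> \<open>Both \<open>a + (b + c)\<close> and \<open>(a + b) + c\<close> split by the
    independent case, and \<open>f c\<close> cancels.\<close>
  obtain c where c: "c \<notin> vs1.span {a}" using off_line by blast
  have out: "c \<notin> vs1.span {x}" if "x \<in> vs1.span {a}" for x
    using c vs1.span_minimal[of "{x}" "vs1.span {a}"] that by auto
  have "b + c \<notin> vs1.span {a}"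
    using c vs1.span_add_eq[OF b] by simp
  then have "f (a + (b + c)) = f a + (f b + f c)"
    using add_independent out[OF b] by metis
  moreover have "a + b \<in> vs1.span {a}" using b by (simp add: vs1.span_add vs1.span_base)
  from add_independent[OF out[OF this]] have "f (a + b + c) = f (a + b) + f c" .
  ultimately show ?thesis by (simp add: add.assoc)
qed

section \<open>The field automorphism\<close>

lemma same_scalar_independent:
  assumes ab: "b \<notin> vs1.span {a}" "a \<noteq> 0" and k: "f (s1 x a) = s2 k (f a)"
  shows "f (s1 x b) = s2 k (f b)"
proof -
  obtain l where l: "f (s1 x b) = s2 l (f b)" using f_scale by blast
  \<comment> \<open>The scalar \<open>m\<close> belonging to \<open>a + b\<close> must agree with
    both \<open>k\<close> and \<open>l\<close> by comparing coordinates.\<close>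
  obtain m where m: "f (s1 x (a + b)) = s2 m (f (a + b))" using f_scale by blast
  have "s2 k (f a) + s2 l (f b) = s2 m (f a) + s2 m (f b)"
    using m by (simp add: k l add vs1.scale_right_distrib vs2.scale_right_distrib)
  from coeffs_eq[OF ab this] l show ?thesis by simp
qed

lemma same_scalar:
  assumes a: "a \<noteq> 0" and k: "f (s1 x a) = s2 k (f a)"
  shows "f (s1 x b) = s2 k (f b)"
proof (cases "b \<in> vs1.span {a}")
  case False
  then show ?thesis using same_scalar_independent assms by blast
next
  case b: True
  \<comment> \<open>The scalar passes from \<open>a\<close> to \<open>c\<close> and from there back
    to \<open>b\<close>.\<close>
  obtain c where c: "c \<notin> vs1.span {a}" using off_line by blast
  then have "c \<noteq> 0" using vs1.span_zero by metis
  have "b \<notin> vs1.span {c}" if "b \<noteq> 0"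
  proof
    assume "b \<in> vs1.span {c}"
    then have "c \<in> vs1.span {b}" using vs1.in_span_insert[of b c "{}"] that by auto
    then show False using c b vs1.span_minimal[of "{b}" "vs1.span {a}"] by auto
  qed
  then show ?thesis
    using same_scalar_independent[OF _ \<open>c \<noteq> 0\<close>] same_scalar_independent[OF c a k]
    by (cases "b = 0") auto
qed

lemma semilinear: "\<exists>\<tau>. field_automorphism \<tau> \<and> tau_linear s1 s2 \<tau> f"
proof -
  obtain a where "a \<notin> vs1.span {0}" using off_line by blast
  then have a: "a \<noteq> 0" by auto
  then have fa: "f a \<noteq> 0" by simp
  obtain \<tau> where \<tau>: "f (s1 x a) = s2 (\<tau> x) (f a)" for x
    using choice[of "\<lambda>x c. f (s1 x a) = s2 c (f a)"] f_scale by blast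
  have scale: "f (s1 x b) = s2 (\<tau> x) (f b)" for x b by (rule same_scalar[OF a \<tau>])
  have "\<tau> x = \<tau> y \<Longrightarrow> x = y" for x y
    using \<tau> injD[OF inj] a by (metis vs1.scale_right_imp_eq)
  moreover have "\<exists>x. c = \<tau> x" for c
  proof -
    have "s2 c (f a) \<in> f ` vs1.span {a}" by (simp add: image_span vs2.span_base vs2.span_scale)
    then obtain x where "s2 c (f a) = s2 (\<tau> x) (f a)" by (auto simp: vs1.span_singleton \<tau>)
    then show ?thesis using fa by auto
  qed
  moreover have "\<tau> 1 = 1" using \<tau>[of 1] fa vs2.scale_right_imp_eq[of "f a" 1 "\<tau> 1"] by simp
  moreover have "\<tau> (x + y) = \<tau> x + \<tau> y" for x y
  proof -
    have "s2 (\<tau> (x + y)) (f a) = s2 (\<tau> x + \<tau> y) (f a)"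
      by (simp add: \<tau>[symmetric] add vs1.scale_left_distrib vs2.scale_left_distrib)
    then show ?thesis using fa by simp
  qed
  moreover have "\<tau> (x * y) = \<tau> x * \<tau> y" for x y
  proof -
    have "s2 (\<tau> (x * y)) (f a) = f (s1 x (s1 y a))" by (simp add: \<tau>[symmetric])
    \<comment> \<open>Here \<open>scale\<close> is applied at the vector \<open>s1 y a\<close> as
      well as at \<open>a\<close>.\<close>
    also have "\<dots> = s2 (\<tau> x * \<tau> y) (f a)" by (simp only: scale vs2.scale_scale)
    finally show ?thesis using fa by simp
  qed
  ultimately have "field_automorphism \<tau>"
    unfolding field_isomorphism_def bij_def inj_def surj_def by blast
  moreover have "tau_linear s1 s2 \<tau> f"
    using scale add by (simp add: tau_linear_def additive_def)
  ultimately show ?thesis by blast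
qed

end

section \<open>Removing the normalisation, and the converse\<close>

context vector_space_pair
begin

lemma affine_line_translate: "affine_line s2 L \<Longrightarrow> affine_line s2 ((\<lambda>x. x + t) ` L)"
proof -
  assume "affine_line s2 L"
  then obtain p d where "d \<noteq> 0" and L: "L = range (\<lambda>c. p + s2 c d)"
    by (auto simp: affine_line_def full_SetCompr_eq)
  moreover have "(\<lambda>x. x + t) ` L = range (\<lambda>c. (p + t) + s2 c d)"
    unfolding L image_image by (simp add: ac_simps)
  ultimately show ?thesis by (auto simp: affine_line_def full_SetCompr_eq)
qed

text \<open>If \<open>f x = f y\<close> with \<open>x\<close> and \<open>y\<close> distinct, a line
  through \<open>x\<close> that avoids \<open>y\<close> has \<open>f y\<close> in its image. Any
  direction outside the span of \<open>y - x\<close> gives such a line.\<close>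

lemma inj_of_off_line:
  assumes dim: "vs1.dim_at_least 2"
    and off: "\<And>L v. affine_line s1 L \<Longrightarrow> v \<notin> L \<Longrightarrow> f v \<notin> f ` L"
  shows "inj f"
proof (rule injI, rule ccontr)
  fix x y assume eq: "f x = f y" and "x \<noteq> y"
  obtain c where c: "c \<notin> vs1.span {y - x}" using vs1.dim_at_least_2_off_line[OF dim] by blast
  have "c \<noteq> 0" using c vs1.span_zero by metis
  define L where "L = range (\<lambda>k. x + s1 k c)"
  have "affine_line s1 L"
    using \<open>c \<noteq> 0\<close> by (auto simp: L_def affine_line_def full_SetCompr_eq)
  moreover have "y \<notin> L"
  proof
    assume "y \<in> L"
    then obtain k where "y = x + s1 k c" by (auto simp: L_def)
    then have k: "y - x = s1 k c" by simp
    then have "k \<noteq> 0" using \<open>x \<noteq> y\<close> by auto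
    then have "c = s1 (1 / k) (y - x)" by (simp add: k)
    then show False using c vs1.span_scale[OF vs1.span_base, of "y - x" "{y - x}"] by auto
  qed
  moreover have "x \<in> L" unfolding L_def by (rule range_eqI[of _ _ 0]) simp
  then have "f y \<in> f ` L" using eq by (metis imageI)
  ultimately show False using off by blast
qed

lemma tau_affine_linear_of_line_map:
  assumes inj: "inj f" and dim: "vs1.dim_at_least 2"
    and scalar: "\<exists>k::'a. k \<noteq> 0 \<and> k \<noteq> 1"
    and line: "\<And>L. affine_line s1 L \<Longrightarrow> affine_line s2 (f ` L)"
  shows "\<exists>\<tau>. field_automorphism \<tau> \<and> tau_affine_linear s1 s2 \<tau> f"
proof -
  define g where "g v = f v - f 0" for v
  have "injective_line_map s1 s2 g"
  proof unfold_locales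
    show "inj g" using inj by (auto simp: inj_def g_def)
    show "g 0 = 0" by (simp add: g_def)
    show "affine_line s2 (g ` L)" if "affine_line s1 L" for L
      using affine_line_translate[OF line[OF that], of "- f 0"] by (simp add: g_def image_image)
  qed (use scalar vs1.dim_at_least_2_off_line[OF dim] in blast)+
  from injective_line_map.semilinear[OF this]
  obtain \<tau> where "field_automorphism \<tau>" "tau_linear s1 s2 \<tau> g" by blast
  moreover have "f = (\<lambda>w. w + f 0) \<circ> g" by (auto simp: g_def)
  ultimately show ?thesis unfolding tau_affine_linear_def by blast
qed

lemma line_map_of_tau_affine_linear:
  assumes inj: "inj f" and \<tau>: "field_automorphism \<tau>" and f: "tau_affine_linear s1 s2 \<tau> f"
    and L: "affine_line s1 L"
  shows "affine_line s2 (f ` L)"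
proof -
  obtain g t where g: "additive g" "\<And>c v. g (s1 c v) = s2 (\<tau> c) (g v)" and f: "\<And>v. f v = g v + t"
    using f by (auto simp: tau_affine_linear_def tau_linear_def)
  obtain p d where d: "d \<noteq> 0" and L: "L = range (\<lambda>c. p + s1 c d)"
    using L by (auto simp: affine_line_def full_SetCompr_eq)
  have "g d \<noteq> 0"
    using injD[OF inj, of d 0] d by (auto simp: f additive.zero[OF g(1)])
  moreover have "f ` L = range (\<lambda>c. f p + s2 c (g d))"
  proof -
    \<comment> \<open>Surjectivity of \<tau> makes the image the whole line.\<close>
    have "f ` L = (\<lambda>c. f p + s2 c (g d)) ` range \<tau>"
      unfolding L image_image by (simp add: f g(2) additive.add[OF g(1)] ac_simps)
    moreover have "range \<tau> = UNIV" using \<tau> by (simp add: field_isomorphism_def bij_def)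
    ultimately show ?thesis by simp
  qed
  ultimately show ?thesis by (auto simp: affine_line_def full_SetCompr_eq)
qed

end

theorem theorem1p8:
  fixes scaleV :: "'a::field \<Rightarrow> 'v::ab_group_add \<Rightarrow> 'v"
    and scaleW :: "'a \<Rightarrow> 'w::ab_group_add \<Rightarrow> 'w"
    and f :: "'v \<Rightarrow> 'w"
  assumes "vector_space scaleV" and "vector_space scaleW"
    and "\<not> (\<exists>\<phi> :: 'a \<Rightarrow> bit. field_isomorphism \<phi>)"
    and "vector_space.dim_at_least scaleV 2"
  shows "((\<forall>L. affine_line scaleV L \<longrightarrow> affine_line scaleW (f ` L)) \<and>
          (\<forall>L v. affine_line scaleV L \<and> v \<notin> L \<longrightarrow> f v \<notin> f ` L) \<longrightarrow>
          inj f \<and> (\<exists>\<tau>. field_automorphism \<tau> \<and> tau_affine_linear scaleV scaleW \<tau> f))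
       \<and> (inj f \<and> (\<exists>\<tau>. field_automorphism \<tau> \<and> tau_affine_linear scaleV scaleW \<tau> f) \<longrightarrow>
          (\<forall>L. affine_line scaleV L \<longrightarrow> affine_line scaleW (f ` L)) \<and>
          (\<forall>L v. affine_line scaleV L \<and> v \<notin> L \<longrightarrow> f v \<notin> f ` L))"
proof -
  interpret vector_space_pair scaleV scaleW
    using assms(1,2) by (rule vector_space_pair.intro)
  note scalar = exists_scalar_neq_0_1[OF assms(3)]
  show ?thesis (is "(?lines \<and> ?off \<longrightarrow> inj f \<and> ?semi) \<and> _")
  proof (rule conjI; rule impI)
    assume "?lines \<and> ?off"
    then have line: "affine_line scaleV L \<Longrightarrow> affine_line scaleW (f ` L)"
      and off: "affine_line scaleV L \<Longrightarrow> v \<notin> L \<Longrightarrow> f v \<notin> f ` L" for L v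
      by simp_all
    have inj: "inj f" by (rule inj_of_off_line[OF assms(4) off])
    with tau_affine_linear_of_line_map[OF inj assms(4) scalar line]
    show "inj f \<and> ?semi" by simp
  next
    assume A: "inj f \<and> ?semi"
    then have inj: "inj f" by simp
    from A obtain \<tau> where "field_automorphism \<tau>" "tau_affine_linear scaleV scaleW \<tau> f" by blast
    then have ?lines using line_map_of_tau_affine_linear[OF inj] by simp
    then show "?lines \<and> ?off" by (simp add: inj_image_mem_iff[OF inj])
  qed
qed

end
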